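(* Let $H_1:\ \dot x_1=f_1(x_1,u_1),\ y_1=h_1(x_1)$ and $H_3:\ \dot x_3=f_3(x_3,u_3),\ y_3=h_3(x_3)-Lu_3$ be single-input-single-output nonlinear negative imaginary (NNI) systems with storage functions $V_1:\mathbb{R}^{n_1}\to\mathbb{R}$ and $V_3:\mathbb{R}^{n_3}\to\mathbb{R}$ respectively, where $L\in\mathbb{R}$, $f_1:\mathbb{R}^{n_1}\times\mathbb{R}\to\mathbb{R}^{n_1}$ and $f_3:\mathbb{R}^{n_3}\times\mathbb{R}\to\mathbb{R}^{n_3}$ are Lipschitz continuous, $h_1:\mathbb{R}^{n_1}\to\mathbb{R}$ and $h_3:\mathbb{R}^{n_3}\to\mathbb{R}$ are of class $C^1$, and $f_1(0,0)=0$, $h_1(0)=0$, $f_3(0,0)=0$, $h_3(0)=0$. Let $\alpha>0$, $b\ge0$, and let $g:\mathbb{R}\to\mathbb{R}$ be of class $C^1$ with $|L\hat u_3+g(\hat u_3)|<b$ for all $\hat u_3\in\mathcal{D}_{\hat u_3}$, where $\mathcal{D}_{\hat u_3}\subset\mathbb{R}$ is a domain containing $0$ (the domain of interest for the output of $H_1$). Put $w=h_3(\hat x_3)-L\hat u_3-g(\hat u_3)$ and consider the saturated controller $$\hat H_3:\quad \dot{\hat x}_3=\begin{cases} f_3(\hat x_3,\hat u_3), & |w|<b,\\ -\alpha\,\dfrac{\partial V_3(\hat x_3)}{\partial \hat x_3}^{\top}, & |w|\ge b,\end{cases}$$ $$\hat y_3=\hat h_3(\hat x_3,\hat u_3)=g(\hat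 u_3)+\mathrm{sat}_b\big(h_3(\hat x_3)-L\hat u_3-g(\hat u_3)\big).$$ Define $$\hat W(x_1,\hat x_3)=V_1(x_1)+V_3(\hat x_3)-\int_0^{h_1(x_1)}\hat h_3(\hat x_3,\xi)\,d\xi,$$ and suppose there exists a compact neighborhood $\mathcal{D}\subset\mathbb{R}^{n_1}\times\mathbb{R}^{n_3}$ of $(0,0)$ such that $\hat W(x_1,\hat x_3)>0$ for all $(x_1,\hat x_3)\in\mathcal{D}\setminus\{(0,0)\}$. Then the equilibrium $(x_1^*,\hat x_3^* )=(0,0)$ of the feedback interconnection of $H_1$ and $\hat H_3$ given by $u_1=\hat y_3$, $\hat u_3=y_1=h_1(x_1)$ is locally stable in the sense of Lyapunov.
   Context: A system $\dot x=f(x,u)$, $y=h(x,u)$ with $x\in\mathbb{R}^n$, $u,y\in\mathbb{R}$ is called nonlinear negative imaginary (NNI) if there is a positive semidefinite storage function $V:\mathbb{R}^n\to\mathbb{R}$ of class $C^1$ (i.e. $V\ge0$ and $V(0)=0$) such that along the system, for all $t\ge0$, $$\dot V(x)\le\int_0^u\frac{\partial}{\partial x}h(x,\xi)\,\dot x\,d\xi,$$ where $\dot x=f(x,u)$ and $\dot V(x)=\frac{\partial V}{\partial x}f(x,u)$. For $H_1$ this means $\dot V_1(x_1)\le u_1\dot h_1(x_1)$ for all $x_1,u_1$, and for $H_3$ it means $\dot V_3(x_3)\le u_3\dot h_3(x_3)$ for all $x_3,u_3$, where $\dot h_i(x_i)=\frac{\partial h_i}{\partial x_i}f_i(x_i,u_i)$.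 The saturation function is $\mathrm{sat}_b(w)=-b$ for $w\le-b$, $\mathrm{sat}_b(w)=w$ for $-b<w<b$, and $\mathrm{sat}_b(w)=b$ for $w\ge b$. An equilibrium $0$ of an autonomous system is locally stable in the sense of Lyapunov if for every $\varepsilon>0$ there is $\delta>0$ such that every solution starting with norm less than $\delta$ stays within norm $\varepsilon$ for all $t\ge0$. *)

theory Defs
  imports "HOL-Analysis.Analysis"
begin

definition grad :: "('a::euclidean_space \<Rightarrow> real) \<Rightarrow> 'a \<Rightarrow> 'a" where
  "grad f x = (THE D. GDERIV f x :> D)"

definition C1_fun :: "('a::euclidean_space \<Rightarrow> real) \<Rightarrow> bool" where
  "C1_fun f \<longleftrightarrow> (\<exists>G. (\<forall>x. GDERIV f x :> G x) \<and> continuous_on UNIV G)"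

definition lipschitz :: "('a::metric_space \<Rightarrow> 'b::metric_space) \<Rightarrow> bool" where
  "lipschitz f \<longleftrightarrow> (\<exists>C. C-lipschitz_on UNIV f)"

(* The system x' = f (x, u), y = h x u is nonlinear negative imaginary with storage function V.
   A trajectory may pass through any state x with any input value u, so the dissipation
   inequality along trajectories is required at every pair (x, u).
   The integral is oriented, i.e. it changes sign when u < 0. *)
definition nni_storage ::
  "('a::euclidean_space \<times> real \<Rightarrow> 'a) \<Rightarrow> ('a \<Rightarrow> real \<Rightarrow> real) \<Rightarrow> ('a \<Rightarrow> real) \<Rightarrow> bool" where
  "nni_storage f h V \<longleftrightarrow>
     C1_fun V \<and> (\<forall>x. 0 \<le> V x) \<and> V 0 = 0 \<and>
     (\<forall>x u. grad V x \<bullet> f (x, u) \<le> (LBINT \<xi>=0..u. grad (\<lambda>z. h z \<xi>) x \<bullet> f (x, u)))"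

definition sat :: "real \<Rightarrow> real \<Rightarrow> real" where
  "sat b w = (if w \<le> - b then - b else if w < b then w else b)"

definition sat_arg ::
  "('a \<Rightarrow> real) \<Rightarrow> real \<Rightarrow> (real \<Rightarrow> real) \<Rightarrow> 'a \<Rightarrow> real \<Rightarrow> real" where
  "sat_arg h3 L g x u = h3 x - L * u - g u"

definition ctrl_dyn ::
  "('a::euclidean_space \<times> real \<Rightarrow> 'a) \<Rightarrow> ('a \<Rightarrow> real) \<Rightarrow> ('a \<Rightarrow> real) \<Rightarrow>
   real \<Rightarrow> real \<Rightarrow> real \<Rightarrow> (real \<Rightarrow> real) \<Rightarrow> 'a \<times> real \<Rightarrow> 'a" where
  "ctrl_dyn f3 h3 V3 L \<alpha> b g = (\<lambda>(x, u).
     if \<bar>sat_arg h3 L g x u\<bar> < b then f3 (x, u) else - \<alpha> *\<^sub>R grad V3 x)"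

definition ctrl_out ::
  "('a \<Rightarrow> real) \<Rightarrow> real \<Rightarrow> real \<Rightarrow> (real \<Rightarrow> real) \<Rightarrow> 'a \<Rightarrow> real \<Rightarrow> real" where
  "ctrl_out h3 L b g x u = g u + sat b (sat_arg h3 L g x u)"

(* Closed-loop vector field of x' = f (x, u), y = h x with z' = fc (z, v), yc = hc z v
   under u = yc, v = y. *)
definition feedback ::
  "('a \<times> real \<Rightarrow> 'a) \<Rightarrow> ('a \<Rightarrow> real) \<Rightarrow> ('c \<times> real \<Rightarrow> 'c) \<Rightarrow> ('c \<Rightarrow> real \<Rightarrow> real) \<Rightarrow>
   'a \<times> 'c \<Rightarrow> 'a \<times> 'c" where
  "feedback f h fc hc = (\<lambda>(x, z). (f (x, hc z (h x)), fc (z, h x)))"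

(* Solutions of x' = F x on a time interval I starting at time 0. F may be discontinuous, so
   the equation is taken in integral form; with the Henstock-Kurzweil integral this comprises
   both the everywhere differentiable and the Caratheodory solutions. *)
definition solution_on :: "('a::euclidean_space \<Rightarrow> 'a) \<Rightarrow> (real \<Rightarrow> 'a) \<Rightarrow> real set \<Rightarrow> bool" where
  "solution_on F x I \<longleftrightarrow>
     is_interval I \<and> 0 \<in> I \<and> I \<subseteq> {0..} \<and> continuous_on I x \<and>
     (\<forall>t\<in>I. ((\<lambda>s. F (x s)) has_integral (x t - x 0)) {0..t})"

(* Solutions need not be global: the bound is required as long as the solution exists, in
   particular for all t >= 0 if I = {0..}. *)
definition lyapunov_stable_equilibrium :: "('a::euclidean_space \<Rightarrow> 'a) \<Rightarrow> bool" where
  "lyapunov_stable_equilibrium F \<longleftrightarrow>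
     F 0 = 0 \<and>
     (\<forall>\<epsilon>>0. \<exists>\<delta>>0. \<forall>I x. solution_on F x I \<longrightarrow> norm (x 0) < \<delta> \<longrightarrow> (\<forall>t\<in>I. norm (x t) < \<epsilon>))"

end

theory Submission
  imports Defs
begin

text \<open>Since \<open>\<bar>g 0\<bar> < b\<close>, continuity keeps the argument of the saturation strictly between \<open>-b\<close> and \<open>b\<close>
  near the origin. So locally the closed loop is the unsaturated interconnection, and the storage
  function \<open>W\<close> equals \<open>V1 x1 + V3 x3 - h1 x1 * h3 x3 + L * (h1 x1)\<^sup>2 / 2\<close>, which is of class \<open>C\<^sup>1\<close>. Its
  derivative along the flow is the sum of the two dissipation defects, hence nonpositive, and
  Lyapunov's direct method applies.\<close>

section \<open>Gradients of functions of class C1\<close>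

lemma grad_eqI:
  assumes "GDERIV f x :> D"
  shows "grad f x = D"
  unfolding grad_def
proof (rule the_equality)
  show "GDERIV f x :> D" by fact
next
  fix E
  assume "GDERIV f x :> E"
  with assms have "(\<lambda>h. h \<bullet> E) = (\<lambda>h. h \<bullet> D)"
    unfolding gderiv_def using has_derivative_unique by blast
  then show "E = D"
    by (simp add: fun_eq_iff vector_eq_ldot)
qed

lemma C1_fun_has_derivative_grad:
  assumes "C1_fun f"
  shows "(f has_derivative (\<lambda>v. grad f x \<bullet> v)) (at x)"
proof -
  obtain D where "GDERIV f x :> D"
    using assms unfolding C1_fun_def by blast
  then show ?thesis
    using grad_eqI[of f x D] by (simp add: gderiv_def inner_commute)
qed

lemma C1_fun_continuous_on: "C1_fun f \<Longrightarrow> continuous_on S f"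
  using C1_fun_has_derivative_grad has_derivative_continuous
  by (blast intro: continuous_at_imp_continuous_on)

section \<open>Lyapunov's direct method for solutions in integral form\<close>

text \<open>A solution is given only through an integral equation. As long as it stays in
  \<open>K\<close>, its integrand is continuous, so it is differentiable by the fundamental theorem
  of calculus, and the mean value theorem applies to \<open>Z\<close> along it.\<close>

lemma nonincreasing_along_solution:
  fixes F :: "'a::euclidean_space \<Rightarrow> 'a"
  assumes sol: "solution_on F x I" and "T \<in> I"
    and F: "continuous_on K F" and K: "\<And>s. s \<in> {0..T} \<Longrightarrow> x s \<in> K"
    and Z: "\<And>y. y \<in> K \<Longrightarrow> (Z has_derivative Z' y) (at y)"
    and dec: "\<And>y. y \<in> K \<Longrightarrow> Z' y (F y) \<le> (0::real)"
  shows "Z (x T) \<le> Z (x 0)"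
proof (cases "T > 0")
  case False
  with \<open>T \<in> I\<close> sol have "T = 0"
    unfolding solution_on_def by force
  then show ?thesis by simp
next
  case True
  have sub: "{0..T} \<subseteq> I"
    using sol \<open>T \<in> I\<close> unfolding solution_on_def is_interval_1 by auto
  have "continuous_on {0..T} x"
    using sol sub unfolding solution_on_def by (blast intro: continuous_on_subset)
  then have contF: "continuous_on {0..T} (\<lambda>s. F (x s))"
    using K by (intro continuous_on_compose2[OF F]) auto
  have x_eq: "x s = x 0 + integral {0..s} (\<lambda>s. F (x s))" if "s \<in> {0..T}" for s
    using sol sub that unfolding solution_on_def by (force simp: integral_unique)
  have x_deriv: "(x has_derivative (\<lambda>h. h *\<^sub>R F (x s))) (at s within {0..T})"
    if s: "s \<in> {0..T}" for s
  proof -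
    have "((\<lambda>u. x 0 + integral {0..u} (\<lambda>s. F (x s))) has_vector_derivative F (x s))
      (at s within {0..T})"
      using integral_has_vector_derivative[OF contF s] by (auto intro!: derivative_eq_intros)
    from has_vector_derivative_transform[of s "{0..T}" x, OF s x_eq this]
    have "(x has_vector_derivative F (x s)) (at s within {0..T})" by simp
    then show ?thesis
      by (simp add: has_vector_derivative_def)
  qed
  have "((\<lambda>s. Z (x s)) has_derivative (\<lambda>h. Z' (x s) (h *\<^sub>R F (x s)))) (at s within {0..T})"
    if "s \<in> {0..T}" for s
    using has_derivative_compose[OF x_deriv[OF that] Z[OF K[OF that]]] by simp
  from mvt_simple[OF True this] obtain s where s: "s \<in> {0<..<T}"
    and eq: "Z (x T) - Z (x 0) = Z' (x s) ((T - 0) *\<^sub>R F (x s))"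
    by auto
  have "x s \<in> K" using K s by auto
  moreover have "linear (Z' (x s))"
    using Z[OF \<open>x s \<in> K\<close>] by (rule has_derivative_linear)
  \<comment> \<open>Linearity takes the positive factor \<open>T\<close> out of \<open>Z'\<close>,
    which leaves the expression bounded by \<open>dec\<close>.\<close>
  ultimately have "Z' (x s) ((T - 0) *\<^sub>R F (x s)) \<le> 0"
    using dec[of "x s"] True by (simp add: linear_scale mult_le_0_iff)
  with eq show ?thesis by simp
qed

text \<open>A solution starting where \<open>Z\<close> is below its minimum on a small sphere cannot
  reach that sphere, since \<open>Z\<close> does not increase up to the first hitting time. All
  assumptions besides \<open>F 0 = 0\<close> and \<open>Z 0 = 0\<close> are confined to a ball, as
  \<open>F\<close> may be discontinuous elsewhere.\<close>

lemma lyapunov_direct_method: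
  fixes F :: "'a::euclidean_space \<Rightarrow> 'a"
  assumes "F 0 = 0" and "R > 0"
    and F: "continuous_on (cball 0 R) F"
    and Z: "\<And>y. y \<in> cball 0 R \<Longrightarrow> (Z has_derivative Z' y) (at y)"
    and dec: "\<And>y. y \<in> cball 0 R \<Longrightarrow> Z' y (F y) \<le> (0::real)"
    and "Z 0 = 0"
    and pos: "\<And>y. y \<in> cball 0 R \<Longrightarrow> y \<noteq> 0 \<Longrightarrow> Z y > 0"
  shows "lyapunov_stable_equilibrium F"
  unfolding lyapunov_stable_equilibrium_def
proof (intro conjI allI impI)
  fix \<epsilon> :: real
  assume "\<epsilon> > 0"
  \<comment> \<open>The bound by \<open>R\<close> puts the sphere of radius \<open>r\<close> where
    \<open>Z\<close> is controlled; the bound by \<epsilon> makes staying inside it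
    sufficient.\<close>
  define r where "r = min \<epsilon> R"
  have r: "r > 0" "r \<le> \<epsilon>" "r \<le> R"
    using \<open>\<epsilon> > 0\<close> \<open>R > 0\<close> by (auto simp: r_def)
  have Z_cont: "isCont Z y" if "y \<in> cball 0 R" for y
    using Z[OF that] by (rule has_derivative_continuous)
  obtain v :: 'a where "norm v = r"
    using vector_choose_size[of r] r by auto
  then have "sphere (0::'a) r \<noteq> {}" by auto
  moreover have "continuous_on (sphere 0 r) Z"
    using Z_cont r by (intro continuous_at_imp_continuous_on) auto
  ultimately obtain y0 where y0: "y0 \<in> sphere 0 r" and min: "\<And>y. y \<in> sphere 0 r \<Longrightarrow> Z y0 \<le> Z y"
    using continuous_attains_inf[of "sphere (0::'a) r" Z] by auto
  have "Z y0 > 0"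
    using pos[of y0] y0 r by auto
  then have "\<forall>\<^sub>F y in nhds 0. Z y < Z y0"
    using Z_cont[of 0] \<open>R > 0\<close> \<open>Z 0 = 0\<close>
    by (intro order_tendstoD(2)[of _ "Z 0"]) (auto simp: continuous_within tendsto_nhds_iff)
  then obtain d where d: "d > 0" "\<And>y. norm y < d \<Longrightarrow> Z y < Z y0"
    by (auto simp: eventually_nhds_metric)
  show "\<exists>\<delta>>0. \<forall>I x. solution_on F x I \<longrightarrow> norm (x 0) < \<delta> \<longrightarrow> (\<forall>t\<in>I. norm (x t) < \<epsilon>)"
  \<comment> \<open>\<open>d\<close> keeps the initial value of \<open>Z\<close> below its minimum
    on the sphere; \<open>r\<close> makes the solution start inside the sphere, so that leaving
    means crossing it.\<close>
  proof (intro exI[of _ "min d r"] conjI allI impI ballI)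
    show "min d r > 0" using d r by simp
    fix I x t
    assume sol: "solution_on F x I" and x0: "norm (x 0) < min d r" and t: "t \<in> I"
    have t0: "0 \<le> t" and sub: "{0..t} \<subseteq> I"
      using sol t unfolding solution_on_def is_interval_1 by auto
    have contx: "continuous_on {0..t} x"
      using sol sub unfolding solution_on_def by (blast intro: continuous_on_subset)
    have "norm (x t) < r"
    proof (rule ccontr)
      assume "\<not> norm (x t) < r"
      have cont_norm: "continuous_on {0..s} (\<lambda>s. norm (x s))" if "s \<le> t" for s
        using continuous_on_subset[OF contx] that by (intro continuous_on_norm) auto
      have hit: "\<exists>s'\<ge>0. s' \<le> s \<and> norm (x s') = r" if "r \<le> norm (x s)" "0 \<le> s" "s \<le> t" for s
        using IVT'[of "\<lambda>s. norm (x s)" 0 r s] x0 that cont_norm by auto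
      define S where "S = {s \<in> {0..t}. norm (x s) = r}"
      have "closed S"
        unfolding S_def by (intro continuous_closed_preimage_constant cont_norm) auto
      then have "compact S"
        using bounded_subset[of "{0..t}" S] bounded_closed_interval[of 0 t]
        unfolding S_def compact_eq_bounded_closed by blast
      moreover have "S \<noteq> {}"
        using hit[of t] \<open>\<not> norm (x t) < r\<close> t0 by (auto simp: S_def)
      \<comment> \<open>\<open>T\<close> is the first time on the sphere. Exceeding norm
        \<open>r\<close> before \<open>T\<close> would force a still earlier crossing, so the
        solution stays in the ball up to \<open>T\<close>.\<close>
      ultimately obtain T where T: "T \<in> S" and first: "\<And>s. s \<in> S \<Longrightarrow> T \<le> s"
        using compact_attains_inf by metis
      have "x s \<in> cball 0 R" if s: "s \<in> {0..T}" for s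
      proof -
        have "norm (x s) \<le> r"
        proof (rule ccontr)
          assume "\<not> norm (x s) \<le> r"
          moreover from this s T have "s < T" "s \<le> t"
            by (auto simp: S_def less_le)
          ultimately obtain s' where "s' \<in> S" "s' \<le> s"
            using hit[of s] s by (auto simp: S_def)
          with first \<open>s < T\<close> show False by force
        qed
        with r show ?thesis by simp
      qed
      then have "Z (x T) \<le> Z (x 0)"
        using nonincreasing_along_solution[OF sol _ F _ Z dec] T sub by (auto simp: S_def)
      moreover have "Z y0 \<le> Z (x T)"
        using T by (intro min) (auto simp: S_def)
      ultimately show False
        using d(2)[of "x 0"] x0 by simp
    qed
    then show "norm (x t) < \<epsilon>" using r by simp
  qed
qed fact

section \<open>Dissipation inequality, storage integral and saturation near the origin\<close>

lemma has_derivative_compose_grad: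
  assumes "C1_fun f" and "(p has_derivative p') (at z within S)"
  shows "((\<lambda>z. f (p z)) has_derivative (\<lambda>v. grad f (p z) \<bullet> p' v)) (at z within S)"
  using has_derivative_compose[OF assms(2) C1_fun_has_derivative_grad[OF assms(1)]] .

text \<open>The feedthrough term does not depend on the state, so the integrand is constant in \<xi>
  and the oriented integral is a product. The case \<open>L = 0\<close> covers the first
  system.\<close>

lemma nni_storage_grad_le:
  assumes "nni_storage f (\<lambda>x u. h x - L * u) V" and "C1_fun h"
  shows "grad V x \<bullet> f (x, u) \<le> u * (grad h x \<bullet> f (x, u))"
proof -
  have "GDERIV (\<lambda>z. h z - L * \<xi>) x :> grad h x" for \<xi>
    using C1_fun_has_derivative_grad[OF assms(2), of x] unfolding gderiv_def
    by (auto intro!: derivative_eq_intros simp: inner_commute)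
  then have "grad (\<lambda>z. h z - L * \<xi>) x = grad h x" for \<xi>
    by (rule grad_eqI)
  moreover have "grad V x \<bullet> f (x, u) \<le> (LBINT \<xi>=0..u. grad (\<lambda>z. h z - L * \<xi>) x \<bullet> f (x, u))"
    using assms(1) unfolding nni_storage_def by blast
  ultimately have "grad V x \<bullet> f (x, u) \<le> (LBINT \<xi>=0..u. grad h x \<bullet> f (x, u))"
    by simp
  also have "\<dots> = u * (grad h x \<bullet> f (x, u))"
    using interval_integral_const[of 0 u] by (simp add: zero_ereal_def)
  finally show ?thesis .
qed

text \<open>Evaluates the integral in \<open>W\<close> once the saturation is inactive, for either
  sign of \<open>a\<close>.\<close>

lemma interval_integral_linear:
  fixes c L a :: real
  shows "(LBINT \<xi>=0..a. c - L * \<xi>) = c * a - L * a\<^sup>2 / 2"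
proof -
  have "(LBINT \<xi>=ereal 0..ereal a. c - L * \<xi>) = (c * a - L * a\<^sup>2 / 2) - (c * 0 - L * 0\<^sup>2 / 2)"
    by (rule interval_integral_FTC_finite)
      (auto intro!: continuous_intros derivative_eq_intros
        simp flip: has_real_derivative_iff_has_vector_derivative)
  then show ?thesis by (simp add: zero_ereal_def)
qed

text \<open>The term \<open>g u\<close> cancels against the one inside the saturation.\<close>

lemma ctrl_out_unsaturated:
  assumes "\<bar>sat_arg h3 L g x u\<bar> < b"
  shows "ctrl_out h3 L b g x u = h3 x - L * u"
  using assms by (auto simp: ctrl_out_def sat_def sat_arg_def)

text \<open>The vector field needs the bound only at \<xi> equal to \<open>h1 (fst z)\<close>, but
  the integral in \<open>W\<close> needs it at every \<xi> between 0 and that value.\<close>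

lemma eventually_unsaturated:
  fixes h1 :: "'a::euclidean_space \<Rightarrow> real" and h3 :: "'c::euclidean_space \<Rightarrow> real"
  assumes "C1_fun h1" and "C1_fun h3" and "C1_fun g" and "h1 0 = 0" and "h3 0 = 0" and "\<bar>g 0\<bar> < b"
  shows "\<forall>\<^sub>F z in nhds (0, 0). \<forall>\<xi>. \<bar>\<xi>\<bar> \<le> \<bar>h1 (fst z)\<bar> \<longrightarrow> \<bar>sat_arg h3 L g (snd z) \<xi>\<bar> < b"
proof -
  have lim: "(f \<longlongrightarrow> f a) (nhds a)" if "continuous_on UNIV f" for f :: "'d::metric_space \<Rightarrow> real" and a
    using that by (simp add: continuous_on_eq_continuous_at continuous_within tendsto_at_iff_tendsto_nhds)
  \<comment> \<open>The midpoint splits the margin: \<open>c\<close> bounds the part depending on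
    \<xi>, and \<open>b - c\<close> is left for \<open>h3\<close>.\<close>
  define c where "c = (\<bar>g 0\<bar> + b) / 2"
  have c: "\<bar>g 0\<bar> < c" "c < b" using assms by (auto simp: c_def)
  have "\<forall>\<^sub>F \<xi> in nhds 0. \<bar>L * \<xi> + g \<xi>\<bar> < c"
    using c by (intro order_tendstoD(2)[OF lim] continuous_intros C1_fun_continuous_on assms) auto
  then obtain \<eta> where "\<eta> > 0" and \<eta>: "\<And>\<xi>. \<bar>\<xi>\<bar> < \<eta> \<Longrightarrow> \<bar>L * \<xi> + g \<xi>\<bar> < c"
    by (auto simp: eventually_nhds_metric dist_real_def)
  have "\<forall>\<^sub>F z in nhds (0::'a, 0::'c). \<bar>h1 (fst z)\<bar> < \<eta>"
    using \<open>\<eta> > 0\<close> assms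
    by (intro order_tendstoD(2)[OF lim] continuous_intros
        continuous_on_compose2[OF C1_fun_continuous_on[of h1 UNIV]]) auto
  moreover have "\<forall>\<^sub>F z in nhds (0::'a, 0::'c). \<bar>h3 (snd z)\<bar> < b - c"
    using c assms
    by (intro order_tendstoD(2)[OF lim] continuous_intros
        continuous_on_compose2[OF C1_fun_continuous_on[of h3 UNIV]]) auto
  ultimately show ?thesis
  proof eventually_elim
    case (elim z)
    show ?case
    proof (intro allI impI)
      fix \<xi> assume "\<bar>\<xi>\<bar> \<le> \<bar>h1 (fst z)\<bar>"
      then have "\<bar>L * \<xi> + g \<xi>\<bar> < c" using elim by (intro \<eta>) simp
      then show "\<bar>sat_arg h3 L g (snd z) \<xi>\<bar> < b"
        using elim unfolding sat_arg_def by linarith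
    qed
  qed
qed

section \<open>Stability of the saturated interconnection\<close>

theorem theorem3:
  fixes f1 :: "(real ^ 'n1) \<times> real \<Rightarrow> real ^ 'n1"
    and h1 V1 :: "real ^ 'n1 \<Rightarrow> real"
    and f3 :: "(real ^ 'n3) \<times> real \<Rightarrow> real ^ 'n3"
    and h3 V3 :: "real ^ 'n3 \<Rightarrow> real"
    and L \<alpha> b :: real
    and g :: "real \<Rightarrow> real"
    and Du :: "real set"
    and W :: "(real ^ 'n1) \<times> (real ^ 'n3) \<Rightarrow> real"
    and D :: "((real ^ 'n1) \<times> (real ^ 'n3)) set"
  assumes "lipschitz f1" and "lipschitz f3"
    and "C1_fun h1" and "C1_fun h3"
    and "f1 (0, 0) = 0" and "h1 0 = 0" and "f3 (0, 0) = 0" and "h3 0 = 0"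
    and "nni_storage f1 (\<lambda>x u. h1 x) V1"
    and "nni_storage f3 (\<lambda>x u. h3 x - L * u) V3"
    and "\<alpha> > 0" and "b \<ge> 0" and "C1_fun g"
    and "open Du" and "connected Du" and "0 \<in> Du"
    and "\<forall>u\<in>Du. \<bar>L * u + g u\<bar> < b"
    and W_def: "\<And>x1 x3. W (x1, x3) = V1 x1 + V3 x3 - (LBINT \<xi>=0..h1 x1. ctrl_out h3 L b g x3 \<xi>)"
    and "compact D" and "(0, 0) \<in> interior D"
    and "\<forall>z \<in> D - {(0, 0)}. W z > 0"
  shows "lyapunov_stable_equilibrium
           (feedback f1 h1 (ctrl_dyn f3 h3 V3 L \<alpha> b g) (ctrl_out h3 L b g))"
proof -
  have V1: "C1_fun V1" "V1 0 = 0" and V3: "C1_fun V3" "V3 0 = 0"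
    using assms unfolding nni_storage_def by auto
  \<comment> \<open>The bound on \<open>Du\<close> is evaluated at 0, where the linear term
    vanishes; in particular \<open>b\<close> is positive.\<close>
  have "\<bar>g 0\<bar> < b"
    using \<open>0 \<in> Du\<close> \<open>\<forall>u\<in>Du. \<bar>L * u + g u\<bar> < b\<close> by force
  then have "\<forall>\<^sub>F z in nhds (0, 0). \<forall>\<xi>. \<bar>\<xi>\<bar> \<le> \<bar>h1 (fst z)\<bar> \<longrightarrow> \<bar>sat_arg h3 L g (snd z) \<xi>\<bar> < b"
    using assms by (intro eventually_unsaturated)
  moreover have "\<forall>\<^sub>F z in nhds (0, 0). z \<in> D"
    using eventually_nhds_in_open[OF open_interior \<open>(0, 0) \<in> interior D\<close>]
    by (rule eventually_mono) (use interior_subset in blast)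
  ultimately have "\<forall>\<^sub>F z in nhds (0, 0).
      (\<forall>\<xi>. \<bar>\<xi>\<bar> \<le> \<bar>h1 (fst z)\<bar> \<longrightarrow> \<bar>sat_arg h3 L g (snd z) \<xi>\<bar> < b) \<and> z \<in> D"
    by (rule eventually_conj)
  then obtain e where "e > 0"
    and e: "\<And>z. dist z (0, 0) < e \<Longrightarrow>
      (\<forall>\<xi>. \<bar>\<xi>\<bar> \<le> \<bar>h1 (fst z)\<bar> \<longrightarrow> \<bar>sat_arg h3 L g (snd z) \<xi>\<bar> < b) \<and> z \<in> D"
    unfolding eventually_nhds_metric by blast
  \<comment> \<open>Halving fits a closed ball into the open ball of radius
    \<open>e\<close>.\<close>
  define R where "R = e / 2"
  have "R > 0" using \<open>e > 0\<close> by (simp add: R_def)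
  have R: "\<And>\<xi>. \<bar>\<xi>\<bar> \<le> \<bar>h1 (fst z)\<bar> \<Longrightarrow> \<bar>sat_arg h3 L g (snd z) \<xi>\<bar> < b" "z \<in> D"
    if "z \<in> cball 0 R" for z
    using e[of z] \<open>e > 0\<close> that by (simp_all add: R_def flip: zero_prod_def)
  let ?F = "feedback f1 h1 (ctrl_dyn f3 h3 V3 L \<alpha> b g) (ctrl_out h3 L b g)"
  \<comment> \<open>\<open>G\<close> is the closed loop without saturation and \<open>Z\<close> the
    closed form of \<open>W\<close> there. Both formulas are regular on the whole space, and
    \<open>F_eq\<close> and \<open>Z_eq\<close> identify them with the original objects on the
    ball.\<close>
  define G where "G = (\<lambda>z. (f1 (fst z, h3 (snd z) - L * h1 (fst z)), f3 (snd z, h1 (fst z))))"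
  define Z where "Z = (\<lambda>z. V1 (fst z) + V3 (snd z) - (h3 (snd z) * h1 (fst z) - L / 2 * (h1 (fst z) * h1 (fst z))))"
  define Z' where "Z' = (\<lambda>z v. grad V1 (fst z) \<bullet> fst v + grad V3 (snd z) \<bullet> snd v
    - (h3 (snd z) * (grad h1 (fst z) \<bullet> fst v) + h1 (fst z) * (grad h3 (snd z) \<bullet> snd v)
       - L * h1 (fst z) * (grad h1 (fst z) \<bullet> fst v)))"
  have F_eq: "?F z = G z" if "z \<in> cball 0 R" for z
    using R[OF that] by (cases z) (simp add: feedback_def ctrl_dyn_def ctrl_out_unsaturated G_def)
  have Z_eq: "W z = Z z" if "z \<in> cball 0 R" for z
  proof -
    obtain x1 x3 where z: "z = (x1, x3)" by (cases z)
    have "(LBINT \<xi>=0..h1 x1. ctrl_out h3 L b g x3 \<xi>) = (LBINT \<xi>=0..h1 x1. h3 x3 - L * \<xi>)"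
    proof (rule interval_integral_cong)
      \<comment> \<open>The minimum and maximum cover a negative upper limit
        \<open>h1 x1\<close>.\<close>
      fix \<xi> assume "\<xi> \<in> einterval (min 0 (ereal (h1 x1))) (max 0 (ereal (h1 x1)))"
      then have "\<bar>\<xi>\<bar> \<le> \<bar>h1 x1\<bar>"
        by (auto simp: einterval_def min_def max_def split: if_splits)
      then show "ctrl_out h3 L b g x3 \<xi> = h3 x3 - L * \<xi>"
        using R[OF that] z by (intro ctrl_out_unsaturated) auto
    qed
    then show ?thesis
      by (simp add: z W_def Z_def interval_integral_linear power2_eq_square)
  qed
  show ?thesis
  proof (rule lyapunov_direct_method[where Z = Z and Z' = Z'])
    show "R > 0" by fact
    show "?F 0 = 0"
      using F_eq[of 0] \<open>R > 0\<close> assms by (simp add: G_def zero_prod_def)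
    show "Z 0 = 0"
      using V1 V3 \<open>h1 0 = 0\<close> by (simp add: Z_def)
    have f1: "continuous_on UNIV f1" and f3: "continuous_on UNIV f3"
      using assms lipschitz_on_continuous_on unfolding lipschitz_def by blast+
    have h1: "continuous_on (cball 0 R) (\<lambda>z. h1 (fst z))"
      by (rule continuous_on_compose2[OF C1_fun_continuous_on[OF \<open>C1_fun h1\<close>, of UNIV]])
        (auto intro!: continuous_intros)
    have h3: "continuous_on (cball 0 R) (\<lambda>z. h3 (snd z))"
      by (rule continuous_on_compose2[OF C1_fun_continuous_on[OF \<open>C1_fun h3\<close>, of UNIV]])
        (auto intro!: continuous_intros)
    have "continuous_on (cball 0 R) (\<lambda>z. (fst z, h3 (snd z) - L * h1 (fst z)))"
      by (intro continuous_intros h1 h3)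
    from continuous_on_compose2[OF f1 this]
    have f1_cont: "continuous_on (cball 0 R) (\<lambda>z. f1 (fst z, h3 (snd z) - L * h1 (fst z)))"
      by simp
    have "continuous_on (cball 0 R) (\<lambda>z. (snd z, h1 (fst z)))"
      by (intro continuous_intros h1)
    from continuous_on_compose2[OF f3 this]
    have "continuous_on (cball 0 R) (\<lambda>z. f3 (snd z, h1 (fst z)))"
      by simp
    with f1_cont have "continuous_on (cball 0 R) G"
      unfolding G_def by (rule continuous_on_Pair)
    then show "continuous_on (cball 0 R) ?F"
      by (rule continuous_on_eq) (rule F_eq[symmetric])
    fix z :: "(real ^ 'n1) \<times> (real ^ 'n3)"
    assume z: "z \<in> cball 0 R"
    have fst_deriv: "((\<lambda>z. f (fst z)) has_derivative (\<lambda>v. grad f (fst z) \<bullet> fst v)) (at z)"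
      if "C1_fun f" for f :: "real ^ 'n1 \<Rightarrow> real"
      using that by (rule has_derivative_compose_grad) (rule has_derivative_fst[OF has_derivative_ident])
    have snd_deriv: "((\<lambda>z. f (snd z)) has_derivative (\<lambda>v. grad f (snd z) \<bullet> snd v)) (at z)"
      if "C1_fun f" for f :: "real ^ 'n3 \<Rightarrow> real"
      using that by (rule has_derivative_compose_grad) (rule has_derivative_snd[OF has_derivative_ident])
    have "(Z has_derivative (\<lambda>v. grad V1 (fst z) \<bullet> fst v + grad V3 (snd z) \<bullet> snd v
          - ((h3 (snd z) * (grad h1 (fst z) \<bullet> fst v) + (grad h3 (snd z) \<bullet> snd v) * h1 (fst z))
            - L / 2 * (h1 (fst z) * (grad h1 (fst z) \<bullet> fst v) + (grad h1 (fst z) \<bullet> fst v) * h1 (fst z)))))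
        (at z)"
      unfolding Z_def
      by (rule has_derivative_diff has_derivative_add has_derivative_mult_right has_derivative_mult
          fst_deriv snd_deriv V1 V3 \<open>C1_fun h1\<close> \<open>C1_fun h3\<close>)+
    then show "(Z has_derivative Z' z) (at z)"
      by (rule has_derivative_eq_rhs) (rule ext, simp add: Z'_def algebra_simps)
    have "Z' z (?F z) = Z' z (G z)"
      using F_eq[OF z] by simp
    also have "\<dots> \<le> 0"
    proof -
      \<comment> \<open>Both dissipation inequalities are taken at the inputs of the
        interconnection, \<open>h3 (snd z) - L * h1 (fst z)\<close> and \<open>h1 (fst z)\<close>.
        The terms of \<open>Z'\<close> along \<open>G\<close> regroup exactly into the sum of the
        two defects.\<close>
      have "nni_storage f1 (\<lambda>x u. h1 x - 0 * u) V1"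
        using assms by simp
      from nni_storage_grad_le[OF this \<open>C1_fun h1\<close>, of "fst z" "h3 (snd z) - L * h1 (fst z)"]
        nni_storage_grad_le[OF assms(10) \<open>C1_fun h3\<close>, of "snd z" "h1 (fst z)"]
      show ?thesis
        by (simp add: Z'_def G_def algebra_simps)
    qed
    finally show "Z' z (?F z) \<le> 0" .
    show "Z z > 0" if "z \<noteq> 0"
    proof -
      have "z \<in> D - {(0, 0)}"
        using that R(2)[OF z] by (simp add: zero_prod_def)
      then have "W z > 0"
        using \<open>\<forall>z\<in>D - {(0, 0)}. W z > 0\<close> by blast
      then show ?thesis
        using Z_eq[OF z] by simp
    qed
  qed
qed

end
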